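(* Let $f:\Omega\subseteq\mathbb{E}_2\to\mathbb{R}$ be strongly differentiable at a point $\mathbf{x}_0$ internal to $\Omega$. Then $$\lim_{\substack{(\mathbf{a},\mathbf{b},\mathbf{c})\to(\mathbf{x}_0,\mathbf{x}_0,\mathbf{x}_0)\\ \mathbf{a},\mathbf{b},\mathbf{c}\text{ not collinear}}}\Big(\overline{\mathbf{\Delta}}f_{(\mathbf{a},\mathbf{b},\mathbf{c})}\Big)\big(\Delta_{(\mathbf{a},\mathbf{b},\mathbf{c})}\big)^{-1}=\nabla f(\mathbf{x}_0),$$ where the product and the inverse are those of the Clifford algebra $\mathbb{G}_2$, and the limit is taken over triples of points of $\Omega$ for which the mirrored point $\bar{\mathbf{a}}$ also lies in $\Omega$ (which is automatic when $\mathbf{a},\mathbf{b},\mathbf{c}$ are close enough to $\mathbf{x}_0$).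
   Context: $\mathbb{E}_n$ is the $n$-dimensional real Euclidean vector space with scalar product $\mathbf{u}\cdot\mathbf{v}$; its vectors are also called points. $\mathbb{G}_n=\mathcal{C}\ell(\mathbb{E}_n)$ is the Clifford (geometric) algebra generated by $\mathbb{E}_n$, an associative algebra of dimension $2^n$ with product denoted by juxtaposition and $\mathbf{v}\mathbf{v}=\mathbf{v}\cdot\mathbf{v}$ for every $\mathbf{v}\in\mathbb{E}_n$. For vectors, $\mathbf{u}\wedge\mathbf{v}=\frac12(\mathbf{u}\mathbf{v}-\mathbf{v}\mathbf{u})$. Strong differentiability: $f:\Omega\subseteq\mathbb{E}_n\to\mathbb{R}$ is strongly differentiable at $\mathbf{x}_0$ (a point internal to $\Omega$) if there is a vector $\mathbf{f^*}(\mathbf{x}_0)\in\mathbb{E}_n$ such that for each $\epsilon>0$ there is $\delta>0$ such that for all distinct $\mathbf{u},\mathbf{v}\in\Omega$ with $|\mathbf{u}-\mathbf{x}_0|<\delta$ and $|\mathbf{v}-\mathbf{x}_0|<\delta$ one has $|f(\mathbf{u})-f(\mathbf{v})-\mathbf{f^*}(\mathbf{x}_0)\cdot(\mathbf{u}-\mathbf{v})|<\epsilon|\mathbf{u}-\mathbf{v}|$. In that case $f$ is differentiable at $\mathbf{x}_0$ and $\mathbf{f^*}(\mathbf{x}_0)=\nabla f(\mathbf{x}_0)$. Let $\mathbf{a},\mathbf{b},\mathbf{c}\in\mathbb{E}_2$ be not collinear, i.e. the vertices of a non degenerate triangle. Define $$\Delta_{(\mathbf{a},\mathbf{b},\mathbf{c})}=(\mathbf{b}-\mathbf{a})\wedge(\mathbf{c}-\mathbf{a}),$$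 which is invertible in $\mathbb{G}_2$, and the multi-difference vector $$\mathbf{\Delta}f_{(\mathbf{a},\mathbf{b},\mathbf{c})}=[f(\mathbf{b})-f(\mathbf{a})](\mathbf{c}-\mathbf{a})-[f(\mathbf{c})-f(\mathbf{a})](\mathbf{b}-\mathbf{a})\in\mathbb{E}_2 .$$ Let $\bar{\mathbf{a}}$ be the point obtained by mirroring (orthogonally reflecting) $\mathbf{a}$ through the line passing through $\mathbf{b}$ and $\mathbf{c}$, that is $\bar{\mathbf{a}}=\mathbf{b}+(\mathbf{c}-\mathbf{b})(\mathbf{a}-\mathbf{b})(\mathbf{c}-\mathbf{b})^{-1}=2\mathbf{b}-2\frac{(\mathbf{c}-\mathbf{b})\cdot(\mathbf{b}-\mathbf{a})}{|\mathbf{c}-\mathbf{b}|^2}(\mathbf{c}-\mathbf{b})-\mathbf{a}$. The mean multi-difference vector is $$\overline{\mathbf{\Delta}}f_{(\mathbf{a},\mathbf{b},\mathbf{c})}=\tfrac12\Big(\mathbf{\Delta}f_{(\mathbf{a},\mathbf{b},\mathbf{c})}-\mathbf{\Delta}f_{(\bar{\mathbf{a}},\mathbf{b},\mathbf{c})}\Big).$$ *)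

theory Defs
  imports "HOL-Analysis.Analysis"
begin

section \<open>The Clifford algebra of \<open>real ^ 'n\<close>\<close>

text \<open>
  An element is stored by its coefficients on the basis blades
  \<open>e\<^sub>A = e\<^bsub>i\<^esub> e\<^bsub>j\<^esub> \<dots>\<close> (\<open>A = {i < j < \<dots>}\<close>), one for each set \<open>A\<close> of indices.
  The linear order on \<open>'n\<close> only fixes the order of the factors in a blade.
\<close>

typedef 'n clifford = "UNIV :: ('n set \<Rightarrow> real) set"
  morphisms coef Clifford
  by simp

lemma coef_Clifford [simp]: "coef (Clifford g) = g"
  by (simp add: Clifford_inverse)

lemma clifford_eqI: "(\<And>A. coef x A = coef y A) \<Longrightarrow> x = y"
  by (metis coef_inverse ext)

lemma clifford_eq_iff: "x = y \<longleftrightarrow> (\<forall>A. coef x A = coef y A)"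
  by (metis clifford_eqI)

instantiation clifford :: (type) real_vector
begin

definition "0 = Clifford (\<lambda>A. 0)"
definition "x + y = Clifford (\<lambda>A. coef x A + coef y A)"
definition "x - y = Clifford (\<lambda>A. coef x A - coef y A)"
definition "- x = Clifford (\<lambda>A. - coef x A)"
definition "scaleR r x = Clifford (\<lambda>A. r * coef x A)"

lemma coef_linear [simp]:
  "coef 0 A = 0"
  "coef (x + y) A = coef x A + coef y A"
  "coef (x - y) A = coef x A - coef y A"
  "coef (- x) A = - coef x A"
  "coef (r *\<^sub>R x) A = r * coef x A"
  by (simp_all add: zero_clifford_def plus_clifford_def minus_clifford_def
      uminus_clifford_def scaleR_clifford_def)

instance
  by standard (simp_all add: clifford_eq_iff algebra_simps)

end

lemma coef_sum [simp]: "coef (sum g I) A = (\<Sum>i\<in>I. coef (g i) A)"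
  by (induction I rule: infinite_finite_induct) simp_all

definition blade :: "'n set \<Rightarrow> 'n clifford" where
  "blade A = Clifford (\<lambda>B. if B = A then 1 else 0)"

lemma coef_blade [simp]: "coef (blade A) B = (if B = A then 1 else 0)"
  by (simp add: blade_def)

lemma inj_blade: "inj blade"
  by (metis (mono_tags, lifting) coef_blade injI zero_neq_one)

text \<open>
  The topology of this finite-dimensional space is that of the coefficientwise inner product.
\<close>

instantiation clifford :: (finite) euclidean_space
begin

definition inner_clifford :: "'a clifford \<Rightarrow> 'a clifford \<Rightarrow> real" where
  "inner_clifford x y = (\<Sum>A\<in>UNIV. coef x A * coef y A)"
definition norm_clifford :: "'a clifford \<Rightarrow> real" where
  "norm_clifford x = sqrt (inner x x)"
definition sgn_clifford :: "'a clifford \<Rightarrow> 'a clifford" where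
  "sgn_clifford x = x /\<^sub>R norm x"
definition dist_clifford :: "'a clifford \<Rightarrow> 'a clifford \<Rightarrow> real" where
  "dist_clifford x y = norm (x - y)"
definition uniformity_clifford :: "('a clifford \<times> 'a clifford) filter" where
  "uniformity_clifford = (INF e\<in>{0 <..}. principal {(x, y). dist x y < e})"
definition open_clifford :: "'a clifford set \<Rightarrow> bool" where
  "open_clifford U \<longleftrightarrow> (\<forall>x\<in>U. eventually (\<lambda>(x', y). x' = x \<longrightarrow> y \<in> U) uniformity)"
definition Basis_clifford :: "'a clifford set" where
  "Basis_clifford = range blade"

lemma inner_blade: "inner x (blade A) = coef x A"
proof -
  have "inner x (blade A) = (\<Sum>B\<in>UNIV. if B = A then coef x B else 0)"
    unfolding inner_clifford_def by (rule sum.cong) auto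
  then show ?thesis by simp
qed

instance
proof
  fix x y z :: "'a clifford" and r :: real
  show "inner x y = inner y x"
    by (simp add: inner_clifford_def mult.commute)
  show "inner (x + y) z = inner x z + inner y z"
    by (simp add: inner_clifford_def sum.distrib algebra_simps)
  show "inner (r *\<^sub>R x) y = r * inner x y"
    by (simp add: inner_clifford_def sum_distrib_left algebra_simps)
  show "0 \<le> inner x x"
    by (simp add: inner_clifford_def sum_nonneg)
  show "inner x x = 0 \<longleftrightarrow> x = 0"
    by (simp add: inner_clifford_def sum_nonneg_eq_0_iff clifford_eq_iff)
  show "(\<forall>u\<in>Basis. inner x u = 0) \<longleftrightarrow> x = 0"
    by (simp add: Basis_clifford_def inner_blade clifford_eq_iff)
next
  fix u v :: "'a clifford"
  assume "u \<in> Basis" "v \<in> Basis"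
  then show "inner u v = (if u = v then 1 else 0)"
    by (auto simp: Basis_clifford_def inner_blade inj_eq[OF inj_blade])
qed (simp_all add: norm_clifford_def sgn_clifford_def dist_clifford_def
      uniformity_clifford_def open_clifford_def Basis_clifford_def)

end

lemma DIM_clifford: "DIM('n::finite clifford) = 2 ^ CARD('n)"
proof -
  have "DIM('n clifford) = card (UNIV :: 'n set set)"
    unfolding Basis_clifford_def by (rule card_image) (rule inj_blade)
  also have "\<dots> = 2 ^ CARD('n)"
    by (metis Pow_UNIV card_Pow finite)
  finally show ?thesis .
qed

text \<open>
  Sorting the factors of \<open>e\<^sub>A e\<^sub>B\<close> takes one transposition, hence one sign change, for each
  pair \<open>(i, j) \<in> A \<times> B\<close> with \<open>j < i\<close>; the equal neighbours that result then
  cancel, because \<open>e\<^bsub>i\<^esub> e\<^bsub>i\<^esub> = 1\<close>. Hence \<open>e\<^sub>A e\<^sub>B\<close> is \<open>reorder_sign A B\<close> times the blade of the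
  symmetric difference of \<open>A\<close> and \<open>B\<close>. The coefficient of a product at \<open>C\<close> therefore collects
  the pairs \<open>(A, sym_diff A C)\<close>.
\<close>

definition reorder_sign :: "'n::{finite,linorder} set \<Rightarrow> 'n set \<Rightarrow> real" where
  "reorder_sign A B = (\<Prod>i\<in>A. \<Prod>j\<in>B. if j < i then - 1 else 1)"

lemma prod_sym_diff:
  fixes g :: "'a::finite \<Rightarrow> real"
  assumes "\<And>i. g i * g i = 1"
  shows "prod g (sym_diff A B) = prod g A * prod g B"
proof -
  have 1: "prod g (A \<inter> B) * prod g (A \<inter> B) = 1"
    by (simp add: prod.distrib[symmetric] assms)
  have A: "prod g A = prod g (A - B) * prod g (A \<inter> B)"
    by (subst prod.union_disjoint[symmetric]) (auto intro: prod.cong)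
  have B: "prod g B = prod g (B - A) * prod g (A \<inter> B)"
    by (subst prod.union_disjoint[symmetric]) (auto intro: prod.cong)
  have "prod g (sym_diff A B) = prod g (A - B) * prod g (B - A)"
    by (rule prod.union_disjoint) auto
  also have "\<dots> = prod g (A - B) * prod g (B - A) * (prod g (A \<inter> B) * prod g (A \<inter> B))"
    by (simp add: 1)
  also have "\<dots> = prod g A * prod g B"
    by (simp add: A B algebra_simps)
  finally show ?thesis .
qed

lemma reorder_sign_sym_diff_left:
  "reorder_sign (sym_diff A B) C = reorder_sign A C * reorder_sign B C"
  unfolding reorder_sign_def
  by (rule prod_sym_diff) (auto simp: prod.distrib[symmetric] intro!: prod.neutral)

lemma reorder_sign_sym_diff_right:
  "reorder_sign A (sym_diff B C) = reorder_sign A B * reorder_sign A C"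
  unfolding reorder_sign_def prod.distrib[symmetric]
  by (rule prod.cong[OF refl], rule prod_sym_diff) auto

lemma reorder_sign_empty [simp]: "reorder_sign {} A = 1" "reorder_sign A {} = 1"
  by (simp_all add: reorder_sign_def)

lemma sym_diff_cancel: "sym_diff A (sym_diff A B) = B"
  by blast

lemma sym_diff_assoc: "sym_diff (sym_diff A B) C = sym_diff A (sym_diff B C)"
  by blast

lemma sym_diff_eq_iff: "sym_diff A B = C \<longleftrightarrow> B = sym_diff A C"
  by blast

instantiation clifford :: ("{finite,linorder}") real_algebra_1
begin

definition one_clifford :: "'a clifford" where
  "one_clifford = blade {}"
definition times_clifford :: "'a clifford \<Rightarrow> 'a clifford \<Rightarrow> 'a clifford" where
  "x * y = Clifford (\<lambda>C. \<Sum>A\<in>UNIV.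
     reorder_sign A (sym_diff A C) * coef x A * coef y (sym_diff A C))"

lemma coef_times: "coef (x * y) C =
    (\<Sum>A\<in>UNIV. reorder_sign A (sym_diff A C) * coef x A * coef y (sym_diff A C))"
  by (simp add: times_clifford_def)

instance
proof
  fix x y z :: "'a clifford" and r :: real
  show "x * y * z = x * (y * z)"
  proof (rule clifford_eqI)
    fix D
    let ?s = reorder_sign
    have bij: "bij (sym_diff A)" for A :: "'a set"
      by (rule o_bij[where g = "sym_diff A"]) (simp_all add: fun_eq_iff sym_diff_cancel)
    have "coef (x * y * z) D = (\<Sum>C\<in>UNIV. \<Sum>A\<in>UNIV. ?s C (sym_diff C D) *
        (?s A (sym_diff A C) * coef x A * coef y (sym_diff A C)) * coef z (sym_diff C D))"
      by (simp only: coef_times sum_distrib_left sum_distrib_right)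
    also have "\<dots> = (\<Sum>A\<in>UNIV. \<Sum>C\<in>UNIV. ?s C (sym_diff C D) *
        (?s A (sym_diff A C) * coef x A * coef y (sym_diff A C)) * coef z (sym_diff C D))"
      by (rule sum.swap)
    also have "\<dots> = (\<Sum>A\<in>UNIV. \<Sum>B\<in>UNIV. ?s (sym_diff A B) (sym_diff (sym_diff A B) D) *
        (?s A (sym_diff A (sym_diff A B)) * coef x A * coef y (sym_diff A (sym_diff A B))) *
        coef z (sym_diff (sym_diff A B) D))"
      by (rule sum.cong[OF refl], rule sum.reindex_bij_betw[OF bij, symmetric])
    also have "\<dots> = (\<Sum>A\<in>UNIV. \<Sum>B\<in>UNIV. ?s A (sym_diff A D) * coef x A *
        (?s B (sym_diff B (sym_diff A D)) * coef y B * coef z (sym_diff B (sym_diff A D))))"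
    proof (intro sum.cong refl)
      fix A B
      have *: "sym_diff (sym_diff A B) D = sym_diff B (sym_diff A D)"
        by blast
      have alg: "q * t * (p * a * b) * c = r * a * (t * b * c)" if "p * q = r"
        for p q r t a b c :: real
        using that by auto
      have "?s A B * ?s A (sym_diff B (sym_diff A D)) = ?s A (sym_diff A D)"
        by (simp only: reorder_sign_sym_diff_right[symmetric] sym_diff_cancel)
      then show "?s (sym_diff A B) (sym_diff (sym_diff A B) D) *
          (?s A (sym_diff A (sym_diff A B)) * coef x A * coef y (sym_diff A (sym_diff A B))) *
          coef z (sym_diff (sym_diff A B) D) = ?s A (sym_diff A D) * coef x A *
          (?s B (sym_diff B (sym_diff A D)) * coef y B * coef z (sym_diff B (sym_diff A D)))"
        unfolding * sym_diff_cancel reorder_sign_sym_diff_left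
        by (rule alg)
    qed
    also have "\<dots> = coef (x * (y * z)) D"
      by (simp only: coef_times sum_distrib_left sum_distrib_right)
    finally show "coef (x * y * z) D = coef (x * (y * z)) D" .
  qed
  show "1 * x = x"
  proof (rule clifford_eqI)
    fix C :: "'a set"
    have "coef (1 * x) C = (\<Sum>A\<in>(UNIV :: 'a set set). if A = {} then coef x C else 0)"
      unfolding coef_times one_clifford_def by (rule sum.cong) auto
    then show "coef (1 * x) C = coef x C" by simp
  qed
  show "x * 1 = x"
  proof (rule clifford_eqI)
    fix C
    have "coef (x * 1) C = (\<Sum>A\<in>UNIV. if A = C then coef x C else 0)"
      unfolding coef_times one_clifford_def by (rule sum.cong) auto
    then show "coef (x * 1) C = coef x C" by simp
  qed
  show "(0::'a clifford) \<noteq> 1"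
    by (auto simp: clifford_eq_iff one_clifford_def)
qed (simp_all add: clifford_eq_iff coef_times algebra_simps sum.distrib sum_distrib_left)

end

lemma blade_times: "blade A * blade B = reorder_sign A B *\<^sub>R blade (sym_diff A B)"
proof (rule clifford_eqI)
  fix C
  have "coef (blade A * blade B) C = (\<Sum>A'\<in>UNIV. if A' = A then
      reorder_sign A (sym_diff A C) * (if sym_diff A C = B then 1 else 0) else 0)"
    unfolding coef_times by (rule sum.cong) auto
  also have "\<dots> = reorder_sign A (sym_diff A C) * (if sym_diff A C = B then 1 else 0)"
    by simp
  also have "\<dots> = coef (reorder_sign A B *\<^sub>R blade (sym_diff A B)) C"
    using sym_diff_eq_iff[of A C B] by auto
  finally show "coef (blade A * blade B) C =
      coef (reorder_sign A B *\<^sub>R blade (sym_diff A B)) C" .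
qed

definition vec_cl :: "real ^ 'n::{finite,linorder} \<Rightarrow> 'n clifford" where
  "vec_cl v = (\<Sum>i\<in>UNIV. (v $ i) *\<^sub>R blade {i})"

lemma coef_vec_cl: "coef (vec_cl v) {i} = v $ i"
proof -
  have "coef (vec_cl v) {i} = (\<Sum>j\<in>UNIV. if j = i then v $ i else 0)"
    unfolding vec_cl_def coef_sum by (rule sum.cong) auto
  then show ?thesis by simp
qed

lemma linear_vec_cl: "linear vec_cl"
  by (rule linearI)
     (simp_all add: vec_cl_def scaleR_add_left sum.distrib scaleR_sum_right)

lemma inj_vec_cl: "inj vec_cl"
  by (metis coef_vec_cl injI vec_eq_iff)

lemma vec_cl_anticommutator:
  "vec_cl u * vec_cl v + vec_cl v * vec_cl u = (2 * inner u v) *\<^sub>R 1"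
proof -
  have e: "blade {i} * blade {j} + blade {j} * blade {i} =
      (if i = j then 2 else 0) *\<^sub>R (1 :: 'a clifford)" for i j :: 'a
  proof (cases "i = j")
    case True
    then show ?thesis
      by (simp add: blade_times reorder_sign_def one_clifford_def scaleR_2)
  next
    case False
    then have "sym_diff {i} {j} = {i, j}" "sym_diff {j} {i} = {i, j}" by auto
    moreover have "i < j \<or> j < i" using False by auto
    ultimately show ?thesis using False
      by (auto simp: blade_times reorder_sign_def)
  qed
  have "vec_cl v * vec_cl u = (\<Sum>i\<in>UNIV. \<Sum>j\<in>UNIV. (u $ i * v $ j) *\<^sub>R (blade {j} * blade {i}))"
    unfolding vec_cl_def sum_product
    by (subst sum.swap) (simp add: mult.commute)
  moreover have "vec_cl u * vec_cl v =
      (\<Sum>i\<in>UNIV. \<Sum>j\<in>UNIV. (u $ i * v $ j) *\<^sub>R (blade {i} * blade {j}))"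
    unfolding vec_cl_def sum_product by (simp add: mult.commute)
  ultimately have "vec_cl u * vec_cl v + vec_cl v * vec_cl u =
      (\<Sum>i\<in>UNIV. \<Sum>j\<in>UNIV. (u $ i * v $ j) *\<^sub>R
        (blade {i} * blade {j} + blade {j} * blade {i}))"
    by (simp add: sum.distrib scaleR_add_right)
  also have "\<dots> = (\<Sum>i\<in>UNIV. \<Sum>j\<in>UNIV. if i = j then (2 * (u $ i * v $ i)) *\<^sub>R 1 else 0)"
    unfolding e by (intro sum.cong refl) simp
  also have "\<dots> = (2 * inner u v) *\<^sub>R 1"
    by (simp add: inner_vec_def sum_distrib_left scaleR_sum_left)
  finally show ?thesis .
qed

lemma vec_cl_square: "vec_cl v * vec_cl v = of_real (inner v v)"
proof -
  have "2 *\<^sub>R (vec_cl v * vec_cl v) = 2 *\<^sub>R (of_real (inner v v) :: 'a clifford)"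
    using vec_cl_anticommutator[of v v] by (simp add: scaleR_2 of_real_def flip: scaleR_add_left)
  then show ?thesis by simp
qed

lemma clifford_generated:
  fixes S :: "'n::{finite,linorder} clifford set"
  assumes S: "subspace S" "1 \<in> S" "\<And>x y. x \<in> S \<Longrightarrow> y \<in> S \<Longrightarrow> x * y \<in> S"
    and vec: "range vec_cl \<subseteq> S"
  shows "S = UNIV"
proof -
  have e: "blade {i} \<in> S" for i
  proof -
    have "vec_cl (axis i 1) = (\<Sum>j\<in>UNIV. if j = i then blade {i} else 0)"
      unfolding vec_cl_def by (rule sum.cong) (auto simp: axis_def)
    then have "vec_cl (axis i 1) = blade {i}" by simp
    then show ?thesis using vec by (metis rangeI subsetD)
  qed
  have b: "blade A \<in> S" for A
  proof (induction A rule: finite_induct[OF finite])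
    case 1
    show ?case using S(2) by (simp add: one_clifford_def)
  next
    case (2 i A)
    let ?s = "reorder_sign {i} A"
    have "sym_diff {i} A = insert i A" using 2 by auto
    then have "blade {i} * blade A = ?s *\<^sub>R blade (insert i A)"
      by (simp add: blade_times)
    moreover have "?s \<noteq> 0" by (auto simp: reorder_sign_def)
    ultimately have "blade (insert i A) = (1 / ?s) *\<^sub>R (blade {i} * blade A)" by simp
    then show ?case using S e 2 by (metis subspace_scale)
  qed
  have "x \<in> S" for x
  proof -
    have "x = (\<Sum>A\<in>UNIV. coef x A *\<^sub>R blade A)"
    proof (rule clifford_eqI)
      fix B
      have "coef (\<Sum>A\<in>UNIV. coef x A *\<^sub>R blade A) B = (\<Sum>A\<in>UNIV. if A = B then coef x B else 0)"
        unfolding coef_sum by (rule sum.cong) auto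
      then show "coef x B = coef (\<Sum>A\<in>UNIV. coef x A *\<^sub>R blade A) B" by simp
    qed
    also have "\<dots> \<in> S"
      using b S(1) by (intro subspace_sum subspace_scale) auto
    finally show ?thesis .
  qed
  then show ?thesis by blast
qed

text \<open>Meaningful only for invertible \<open>x\<close>; otherwise the value is unspecified.\<close>

definition cl_inverse :: "'n::{finite,linorder} clifford \<Rightarrow> 'n clifford" where
  "cl_inverse x = (THE y. x * y = 1 \<and> y * x = 1)"

lemma cl_inverse_unique:
  assumes "x * y = 1" "y * x = 1"
  shows "cl_inverse x = y"
  unfolding cl_inverse_def
proof (rule the_equality)
  fix z assume "x * z = 1 \<and> z * x = 1"
  then show "z = y" using assms by (metis mult.assoc mult_1 mult_1_right)
qed (use assms in simp)

lemma cl_inverse_vec_cl: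
  assumes "v \<noteq> 0"
  shows "cl_inverse (vec_cl v) = (1 / inner v v) *\<^sub>R vec_cl v"
  using assms by (intro cl_inverse_unique) (simp_all add: vec_cl_square of_real_def)

definition vec_wedge :: "real ^ 'n::{finite,linorder} \<Rightarrow> real ^ 'n::{finite,linorder} \<Rightarrow> 'n clifford" where
  "vec_wedge u v = (1 / 2) *\<^sub>R (vec_cl u * vec_cl v - vec_cl v * vec_cl u)"

lemma vec_wedge_square:
  "vec_wedge u v * vec_wedge u v = of_real ((inner u v)\<^sup>2 - inner u u * inner v v)"
proof -
  let ?P = "vec_cl u" and ?Q = "vec_cl v" and ?s = "inner u v"
  have QP: "?Q * ?P = (2 * ?s) *\<^sub>R 1 - ?P * ?Q"
    using vec_cl_anticommutator[of u v] by (simp add: eq_diff_eq add.commute)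
  have w: "vec_wedge u v = ?P * ?Q - ?s *\<^sub>R 1"
  proof -
    have "vec_wedge u v = (1 / 2) *\<^sub>R (2 *\<^sub>R (?P * ?Q) - (2 * ?s) *\<^sub>R 1)"
      by (simp add: vec_wedge_def QP scaleR_2)
    then show ?thesis by (simp add: scaleR_diff_right)
  qed
  have "(?P * ?Q) * (?P * ?Q) = ?P * (?Q * ?P) * ?Q"
    by (simp add: mult.assoc)
  also have "\<dots> = (2 * ?s) *\<^sub>R (?P * ?Q) - (?P * ?P) * (?Q * ?Q)"
    unfolding QP by (simp add: right_diff_distrib left_diff_distrib mult.assoc)
  also have "\<dots> = (2 * ?s) *\<^sub>R (?P * ?Q) - (inner u u * inner v v) *\<^sub>R 1"
    by (simp add: vec_cl_square of_real_def)
  finally have "(?P * ?Q) * (?P * ?Q) = (2 * ?s) *\<^sub>R (?P * ?Q) - (inner u u * inner v v) *\<^sub>R 1" .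
  moreover have "(?P * ?Q - ?s *\<^sub>R 1) * (?P * ?Q - ?s *\<^sub>R 1) =
      (?P * ?Q) * (?P * ?Q) - (2 * ?s) *\<^sub>R (?P * ?Q) + (?s * ?s) *\<^sub>R 1"
    unfolding left_diff_distrib right_diff_distrib mult_2 scaleR_add_left by simp
  ultimately show ?thesis
    by (simp add: w of_real_def power2_eq_square scaleR_diff_left)
qed

section \<open>Strong differentiability\<close>

definition has_strong_gradient ::
  "('a::real_inner \<Rightarrow> real) \<Rightarrow> 'a set \<Rightarrow> 'a \<Rightarrow> 'a \<Rightarrow> bool" where
  "has_strong_gradient f \<Omega> x0 g \<longleftrightarrow>
    (\<forall>\<epsilon>>0. \<exists>\<delta>>0. \<forall>u\<in>\<Omega>. \<forall>v\<in>\<Omega>. u \<noteq> v \<and> norm (u - x0) < \<delta> \<and> norm (v - x0) < \<delta> \<longrightarrow>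
      \<bar>f u - f v - inner g (u - v)\<bar> < \<epsilon> * norm (u - v))"

definition strongly_differentiable ::
  "('a::real_inner \<Rightarrow> real) \<Rightarrow> 'a set \<Rightarrow> 'a \<Rightarrow> bool" where
  "strongly_differentiable f \<Omega> x0 \<longleftrightarrow> (\<exists>g. has_strong_gradient f \<Omega> x0 g)"

definition gradient :: "('a::real_inner \<Rightarrow> real) \<Rightarrow> 'a \<Rightarrow> 'a" where
  "gradient f x = (THE D. GDERIV f x :> D)"

lemma gradient_eq:
  assumes "GDERIV f x :> D"
  shows "gradient f x = D"
  unfolding gradient_def
proof (rule the_equality[where P = "\<lambda>D. GDERIV f x :> D", OF assms])
  fix E assume "GDERIV f x :> E"
  then have "(\<lambda>h. inner h E) = (\<lambda>h. inner h D)"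
    using assms unfolding gderiv_def by (rule has_derivative_unique)
  then have "inner (E - D) (E - D) = 0"
    by (metis inner_diff_right right_minus_eq)
  then show "E = D" by simp
qed

lemma has_strong_gradient_imp_gradient:
  assumes "x0 \<in> interior \<Omega>" "has_strong_gradient f \<Omega> x0 g"
  shows "gradient f x0 = g"
proof (rule gradient_eq)
  obtain r where r: "r > 0" "ball x0 r \<subseteq> \<Omega>"
    using assms(1) by (meson mem_interior)
  have x0: "x0 \<in> \<Omega>" using r by (meson centre_in_ball subsetD)
  show "GDERIV f x0 :> g"
    unfolding gderiv_def has_derivative_at_alt
  proof (intro conjI allI impI)
    show "bounded_linear (\<lambda>h. inner h g)" by (rule bounded_linear_inner_left)
    fix e :: real assume "e > 0"
    then obtain d where d: "d > 0" and
      *: "\<And>u v. u \<in> \<Omega> \<Longrightarrow> v \<in> \<Omega> \<Longrightarrow> u \<noteq> v \<Longrightarrow> norm (u - x0) < d \<Longrightarrow> norm (v - x0) < d \<Longrightarrow>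
        \<bar>f u - f v - inner g (u - v)\<bar> < e * norm (u - v)"
      using assms(2) unfolding has_strong_gradient_def by meson
    have "norm (f y - f x0 - inner (y - x0) g) \<le> e * norm (y - x0)"
      if "norm (y - x0) < min d r" for y
    proof (cases "y = x0")
      case False
      have "y \<in> \<Omega>" using r that by (auto simp: dist_norm norm_minus_commute subset_iff)
      then show ?thesis using *[of y x0] False x0 that d by (simp add: inner_commute)
    qed simp
    then show "\<exists>d>0. \<forall>y. norm (y - x0) < d \<longrightarrow>
        norm (f y - f x0 - inner (y - x0) g) \<le> e * norm (y - x0)"
      using d r by (intro exI[of _ "min d r"]) auto
  qed
qed

section \<open>Multi-differences\<close>

definition triangle_bivector :: "real ^ 2 \<Rightarrow> real ^ 2 \<Rightarrow> real ^ 2 \<Rightarrow> 2 clifford" where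
  "triangle_bivector a b c = vec_wedge (b - a) (c - a)"

lemma triangle_bivector_inverse:
  assumes "\<not> collinear {a, b, c}"
  shows "triangle_bivector a b c * cl_inverse (triangle_bivector a b c) = 1"
    and "cl_inverse (triangle_bivector a b c) * triangle_bivector a b c = 1"
proof -
  define B where "B = triangle_bivector a b c"
  define k where "k = (inner (b - a) (c - a))\<^sup>2 - inner (b - a) (b - a) * inner (c - a) (c - a)"
  have B: "B * B = k *\<^sub>R 1"
    by (simp add: B_def triangle_bivector_def vec_wedge_square k_def of_real_def)
  have "\<not> collinear {0, b - a, c - a}"
    using assms collinear_3[of b a c] by (simp add: insert_commute)
  then have "\<bar>inner (b - a) (c - a)\<bar> \<noteq> norm (b - a) * norm (c - a)"
    by (simp add: norm_cauchy_schwarz_equal)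
  then have "k \<noteq> 0"
    unfolding k_def power2_norm_eq_inner[symmetric] power_mult_distrib[symmetric]
      right_minus_eq power2_eq_iff by (auto simp: abs_mult)
  then have 1: "B * ((1 / k) *\<^sub>R B) = 1" "((1 / k) *\<^sub>R B) * B = 1"
    by (simp_all add: B)
  then have "cl_inverse B = (1 / k) *\<^sub>R B" by (rule cl_inverse_unique)
  then show "triangle_bivector a b c * cl_inverse (triangle_bivector a b c) = 1"
    "cl_inverse (triangle_bivector a b c) * triangle_bivector a b c = 1"
    using 1 by (simp_all flip: B_def)
qed

definition multi_diff ::
  "(real ^ 2 \<Rightarrow> real) \<Rightarrow> real ^ 2 \<Rightarrow> real ^ 2 \<Rightarrow> real ^ 2 \<Rightarrow> real ^ 2" where
  "multi_diff f a b c = (f b - f a) *\<^sub>R (c - a) - (f c - f a) *\<^sub>R (b - a)"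

text \<open>Reflection of \<open>a\<close> in the line through \<open>b\<close> and \<open>c\<close>.\<close>

definition mirror :: "real ^ 'n \<Rightarrow> real ^ 'n \<Rightarrow> real ^ 'n \<Rightarrow> real ^ 'n" where
  "mirror a b c = 2 *\<^sub>R b - (2 * (inner (c - b) (b - a) / (norm (c - b))\<^sup>2)) *\<^sub>R (c - b) - a"

lemma vec_cl_mirror:
  fixes a b c :: "real ^ 'n::{finite,linorder}"
  assumes "b \<noteq> c"
  shows "vec_cl (mirror a b c) =
    vec_cl b + vec_cl (c - b) * vec_cl (a - b) * cl_inverse (vec_cl (c - b))"
proof -
  define w where "w = c - b"
  define p where "p = a - b"
  have w: "w \<noteq> 0" using assms by (simp add: w_def)
  have m: "mirror a b c = b + ((2 * inner w p / inner w w) *\<^sub>R w - p)"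
  proof -
    have "inner (c - b) (b - a) = - inner w p"
      by (simp add: w_def p_def inner_diff_right)
    then show ?thesis
      unfolding mirror_def power2_norm_eq_inner
      by (simp add: w_def[symmetric] p_def scaleR_2)
  qed
  have "vec_cl w * vec_cl p = (2 * inner w p) *\<^sub>R 1 - vec_cl p * vec_cl w"
    using vec_cl_anticommutator[of w p] by (simp add: eq_diff_eq)
  then have "vec_cl w * vec_cl p * cl_inverse (vec_cl w) =
      ((2 * inner w p) *\<^sub>R 1 - vec_cl p * vec_cl w) * ((1 / inner w w) *\<^sub>R vec_cl w)"
    by (simp add: cl_inverse_vec_cl[OF w])
  also have "\<dots> = (2 * inner w p / inner w w) *\<^sub>R vec_cl w - vec_cl p"
    using w by (simp add: left_diff_distrib mult.assoc vec_cl_square of_real_def scaleR_diff_right)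
  also have "\<dots> = vec_cl ((2 * inner w p / inner w w) *\<^sub>R w - p)"
    by (simp add: linear_diff[OF linear_vec_cl] linear_scale[OF linear_vec_cl])
  finally show ?thesis
    by (simp add: m linear_add[OF linear_vec_cl] flip: w_def p_def)
qed

definition mean_multi_diff ::
  "(real ^ 2 \<Rightarrow> real) \<Rightarrow> real ^ 2 \<Rightarrow> real ^ 2 \<Rightarrow> real ^ 2 \<Rightarrow> real ^ 2" where
  "mean_multi_diff f a b c = (1 / 2) *\<^sub>R (multi_diff f a b c - multi_diff f (mirror a b c) b c)"

end

theory Submission
  imports Defs
begin

text \<open>
  Write \<open>w = c - b\<close> and \<open>q = a - mirror a b c\<close>. Mirroring makes \<open>q\<close> orthogonal to \<open>w\<close>. The mean
  multi-difference only retains the differences of \<open>f\<close> along these two directions,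
  \<open>\<onehalf> ((f c - f b) q - (f a - f (mirror a b c)) w)\<close>, and the bivector of the triangle is the plain
  Clifford product \<open>\<onehalf> w q\<close>, whose inverse is a multiple of \<open>q w\<close>. As \<open>q q\<close> and \<open>w w\<close> are scalars
  and \<open>w\<close>, \<open>q\<close> anticommute, the quotient collapses to the vector
  \<open>((f c - f b) / |w|\<^sup>2) w + ((f a - f (mirror a b c)) / |q|\<^sup>2) q\<close>
  (\<open>mean_multi_diff_quotient\<close>).

  This is the expansion of a gradient in the orthogonal basis \<open>w, q\<close> of the plane, with the
  directional derivatives replaced by difference quotients. If \<open>f\<close> is linear, it is the gradient
  itself; in general strong differentiability makes the error of each of the two quotients
  small. Since the two directions are always orthogonal, flat triangles do no harm: no bound on
  the angles enters. Finally \<open>mirror a b c\<close> is as far from \<open>b\<close> as \<open>a\<close> is, so it tends to \<open>x0\<close>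
  along with the vertices.
\<close>

section \<open>Reflection in the line through two points\<close>

lemma mirror_displacement:
  "a - mirror a b c =
    2 *\<^sub>R ((a - b) - (inner (c - b) (a - b) / (norm (c - b))\<^sup>2) *\<^sub>R (c - b))"
proof -
  define t where "t = inner (c - b) (a - b) / (norm (c - b))\<^sup>2"
  have "inner (c - b) (b - a) = - inner (c - b) (a - b)"
    by (simp add: inner_diff_right)
  then have "mirror a b c = 2 *\<^sub>R b + (2 * t) *\<^sub>R (c - b) - a"
    unfolding mirror_def t_def by simp
  moreover have "a - (2 *\<^sub>R b + (2 * t) *\<^sub>R w - a) = 2 *\<^sub>R ((a - b) - t *\<^sub>R w)" for w
    by (simp add: vec_eq_iff algebra_simps)
  ultimately have "a - mirror a b c = 2 *\<^sub>R ((a - b) - t *\<^sub>R (c - b))"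
    by (simp only:)
  then show ?thesis by (simp only: t_def)
qed

lemma mirror_displacement_orthogonal: "inner (c - b) (a - mirror a b c) = 0"
proof -
  have "inner w (p - (inner w p / (norm w)\<^sup>2) *\<^sub>R w) = 0" for w p :: "real ^ 'a"
    by (cases "w = 0") (simp_all add: inner_diff_right power2_norm_eq_inner)
  then show ?thesis unfolding mirror_displacement by simp
qed

text \<open>
  The displacement \<open>q\<close> satisfies \<open>|q|\<^sup>2 = 2 (a - b) \<bullet> q\<close>, because \<open>q\<close> is twice the component of
  \<open>a - b\<close> orthogonal to the line; this is what makes the reflection an isometry.
\<close>

lemma norm_mirror_diff: "norm (mirror a b c - b) = norm (a - b)"
proof -
  define p where "p = a - b"
  define w where "w = c - b"
  define q where "q = a - mirror a b c"
  define t where "t = inner w p / (norm w)\<^sup>2"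
  have "q = 2 *\<^sub>R (p - t *\<^sub>R w)"
    unfolding q_def p_def w_def t_def by (rule mirror_displacement)
  then have p: "p = (1 / 2) *\<^sub>R q + t *\<^sub>R w"
    by (simp add: scaleR_diff_right)
  have "inner w q = 0"
    unfolding w_def q_def by (rule mirror_displacement_orthogonal)
  then have pq: "inner p q = inner q q / 2"
    unfolding p by (simp add: inner_add_left)
  have "inner (p - q) (p - q) = inner p p - 2 * inner p q + inner q q"
    by (simp add: inner_diff_left inner_diff_right inner_commute)
  then have "norm (p - q) = norm p"
    unfolding norm_eq_sqrt_inner pq by simp
  then show ?thesis by (simp add: p_def q_def)
qed

lemma mirror_neq:
  assumes "\<not> collinear {a, b, c}"
  shows "mirror a b c \<noteq> a"
proof
  assume eq: "mirror a b c = a"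
  define p where "p = a - b"
  define w where "w = c - b"
  define t where "t = inner w p / (norm w)\<^sup>2"
  have "2 *\<^sub>R (p - t *\<^sub>R w) = a - mirror a b c"
    unfolding p_def w_def t_def by (rule mirror_displacement[symmetric])
  then have "p = t *\<^sub>R w"
    unfolding eq by simp
  then have "collinear {0, w, p}"
    unfolding collinear_lemma by blast
  then have "collinear {c, b, a}"
    unfolding p_def w_def by (subst collinear_3) (simp_all only: NO_MATCH_def)
  moreover have "{c, b, a} = {a, b, c}" by blast
  ultimately show False using assms by simp
qed

section \<open>The quotient as a sum of secant gradients\<close>

text \<open>
  For \<open>u \<noteq> v\<close> this is the only multiple of \<open>u - v\<close> whose inner product with \<open>u - v\<close> is the
  increment \<open>f u - f v\<close>. For a linear \<open>f\<close> it is the projection of the gradient onto the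
  direction of \<open>u - v\<close>.
\<close>

definition secant_gradient :: "('a::real_inner \<Rightarrow> real) \<Rightarrow> 'a \<Rightarrow> 'a \<Rightarrow> 'a" where
  "secant_gradient f u v = ((f u - f v) / (norm (u - v))\<^sup>2) *\<^sub>R (u - v)"

text \<open>
  The terms with \<open>c - a\<close> and \<open>b - a\<close> combine with their mirror images because subtracting the
  mirrored multi-difference replaces both vectors by the displacement of \<open>a\<close>.
\<close>

lemma mean_multi_diff_eq:
  "mean_multi_diff f a b c =
    (1 / 2) *\<^sub>R ((f c - f b) *\<^sub>R (a - mirror a b c) - (f a - f (mirror a b c)) *\<^sub>R (c - b))"
  unfolding mean_multi_diff_def multi_diff_def by (simp add: algebra_simps)

lemma vec_cl_anticommute:
  assumes "inner u v = 0"
  shows "vec_cl v * vec_cl u = - (vec_cl u * vec_cl v)"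
  using vec_cl_anticommutator[of u v] assms by (simp add: eq_neg_iff_add_eq_0 add.commute)

text \<open>
  A triangle has the same area as the right-angled one with legs \<open>c - b\<close> and the height, and the
  height is half of the displacement under reflection. For orthogonal vectors the wedge is the
  Clifford product.
\<close>

lemma triangle_bivector_eq:
  "triangle_bivector a b c = (1 / 2) *\<^sub>R (vec_cl (c - b) * vec_cl (a - mirror a b c))"
proof -
  define q where "q = a - mirror a b c"
  define w where "w = c - b"
  define t where "t = inner (c - b) (a - b) / (norm (c - b))\<^sup>2"
  have q: "q = 2 *\<^sub>R ((a - b) - t *\<^sub>R w)"
    by (simp add: q_def w_def t_def mirror_displacement)
  let ?W = "vec_cl w" and ?Q = "vec_cl q"
  have "b - a = (- 1 / 2) *\<^sub>R q - t *\<^sub>R w"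
    by (simp add: q scaleR_diff_right)
  then have ab: "vec_cl (b - a) = (- 1 / 2) *\<^sub>R ?Q - t *\<^sub>R ?W"
    by (simp only: linear_diff[OF linear_vec_cl] linear_scale[OF linear_vec_cl])
  have "c - a = (1 - t) *\<^sub>R w - (1 / 2) *\<^sub>R q"
    by (simp add: q w_def scaleR_diff_right scaleR_diff_left)
  then have ac: "vec_cl (c - a) = (1 - t) *\<^sub>R ?W - (1 / 2) *\<^sub>R ?Q"
    by (simp only: linear_diff[OF linear_vec_cl] linear_scale[OF linear_vec_cl])
  have anti: "vec_cl q * vec_cl w = - (vec_cl w * vec_cl q)"
    by (rule vec_cl_anticommute) (simp add: q_def w_def mirror_displacement_orthogonal)
  have "triangle_bivector a b c = (1 / 2) *\<^sub>R (vec_cl w * vec_cl q)"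
    unfolding triangle_bivector_def vec_wedge_def ab ac
    by (simp only: left_diff_distrib right_diff_distrib mult_scaleR_left mult_scaleR_right anti)
      (simp add: clifford_eq_iff field_simps)
  then show ?thesis by (simp add: q_def w_def)
qed

text \<open>
  Multiplying \<open>\<alpha> q - \<beta> w\<close> by \<open>(w q)\<^sup>-\<^sup>1\<close>, a multiple of \<open>q w\<close>, exchanges the two vectors:
  \<open>q q w\<close> is a multiple of \<open>w\<close>, and \<open>w q w = - w w q\<close> is a multiple of \<open>q\<close>.
\<close>

lemma orthogonal_pair_quotient:
  fixes w q :: "real ^ 'n::{finite,linorder}"
  assumes ortho: "inner w q = 0" and nz: "w \<noteq> 0" "q \<noteq> 0"
  shows "vec_cl ((1 / 2) *\<^sub>R (\<alpha> *\<^sub>R q - \<beta> *\<^sub>R w)) *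
      cl_inverse ((1 / 2) *\<^sub>R (vec_cl w * vec_cl q)) =
    vec_cl ((\<alpha> / (norm w)\<^sup>2) *\<^sub>R w + (\<beta> / (norm q)\<^sup>2) *\<^sub>R q)"
proof -
  let ?W = "vec_cl w" and ?Q = "vec_cl q"
  define m n where "m = inner w w" and "n = inner q q"
  have mn: "m \<noteq> 0" "n \<noteq> 0" using nz by (simp_all add: m_def n_def)
  have WW: "?W * ?W = m *\<^sub>R 1" and QQ: "?Q * ?Q = n *\<^sub>R 1"
    by (simp_all add: vec_cl_square m_def n_def of_real_def)
  have QW: "?Q * ?W = - (?W * ?Q)"
    using ortho by (rule vec_cl_anticommute)
  have WQQW: "?W * (?Q * (?Q * ?W)) = (m * n) *\<^sub>R 1"
    by (simp add: WW QQ mult.assoc[of ?Q ?Q ?W, symmetric] mult.commute)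
  have QWWQ: "?Q * (?W * (?W * ?Q)) = (m * n) *\<^sub>R 1"
    by (simp add: WW QQ mult.assoc[of ?W ?W ?Q, symmetric])
  have inv: "cl_inverse ((1 / 2) *\<^sub>R (?W * ?Q)) = (2 / (m * n)) *\<^sub>R (?Q * ?W)"
    by (rule cl_inverse_unique) (simp_all add: mult.assoc WQQW QWWQ mn)
  have QQW: "?Q * (?Q * ?W) = n *\<^sub>R ?W"
    by (simp add: QQ mult.assoc[symmetric])
  have WQW: "?W * (?Q * ?W) = - (m *\<^sub>R ?Q)"
    by (simp add: QW WW mult.assoc[symmetric])
  have "vec_cl ((1 / 2) *\<^sub>R (\<alpha> *\<^sub>R q - \<beta> *\<^sub>R w)) = (1 / 2) *\<^sub>R (\<alpha> *\<^sub>R ?Q - \<beta> *\<^sub>R ?W)"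
    by (simp add: linear_diff[OF linear_vec_cl] linear_scale[OF linear_vec_cl])
  then have "vec_cl ((1 / 2) *\<^sub>R (\<alpha> *\<^sub>R q - \<beta> *\<^sub>R w)) * cl_inverse ((1 / 2) *\<^sub>R (?W * ?Q)) =
      (1 / (m * n)) *\<^sub>R (\<alpha> *\<^sub>R (?Q * (?Q * ?W)) - \<beta> *\<^sub>R (?W * (?Q * ?W)))"
    by (simp add: inv left_diff_distrib)
  also have "\<dots> = (\<alpha> / m) *\<^sub>R ?W + (\<beta> / n) *\<^sub>R ?Q"
    using mn by (simp add: QQW WQW scaleR_add_right)
  also have "\<dots> = vec_cl ((\<alpha> / m) *\<^sub>R w + (\<beta> / n) *\<^sub>R q)"
    by (simp add: linear_add[OF linear_vec_cl] linear_scale[OF linear_vec_cl])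
  finally show ?thesis by (simp add: power2_norm_eq_inner m_def n_def)
qed

lemma mean_multi_diff_quotient:
  assumes "\<not> collinear {a, b, c}"
  shows "vec_cl (mean_multi_diff f a b c) * cl_inverse (triangle_bivector a b c) =
    vec_cl (secant_gradient f c b + secant_gradient f a (mirror a b c))"
proof -
  have "c - b \<noteq> 0" using assms by auto
  moreover have "a - mirror a b c \<noteq> 0" using mirror_neq[OF assms] by simp
  ultimately show ?thesis
    unfolding mean_multi_diff_eq triangle_bivector_eq secant_gradient_def
    by (intro orthogonal_pair_quotient mirror_displacement_orthogonal)
qed

section \<open>Convergence of the secant gradients\<close>

lemma orthogonal_expansion_plane:
  fixes w q g :: "real ^ 2"
  assumes ortho: "inner w q = 0" and nz: "w \<noteq> 0" "q \<noteq> 0"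
  shows "(inner g w / (norm w)\<^sup>2) *\<^sub>R w + (inner g q / (norm q)\<^sup>2) *\<^sub>R q = g"
proof -
  define r where "r = g - ((inner g w / (norm w)\<^sup>2) *\<^sub>R w + (inner g q / (norm q)\<^sup>2) *\<^sub>R q)"
  have "inner q w = 0" using ortho by (simp add: inner_commute)
  then have "inner r w = 0" "inner r q = 0"
    using ortho nz by (simp_all add: r_def inner_diff_left inner_add_left power2_norm_eq_inner)
  then have rw: "r $ 1 * w $ 1 + r $ 2 * w $ 2 = 0" and rq: "r $ 1 * q $ 1 + r $ 2 * q $ 2 = 0"
    by (simp_all add: inner_vec_def sum_2)
  have wq: "w $ 1 * q $ 1 + w $ 2 * q $ 2 = 0"
    using ortho by (simp add: inner_vec_def sum_2)
  let ?D = "w $ 1 * q $ 2 - w $ 2 * q $ 1"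
  \<comment> \<open>Lagrange's identity: orthogonal nonzero vectors of the plane have nonzero determinant.\<close>
  have "?D\<^sup>2 = inner w w * inner q q"
    using wq unfolding inner_vec_def sum_2 inner_real_def by algebra
  moreover have "inner w w * inner q q \<noteq> 0" using nz by simp
  ultimately have D: "?D \<noteq> 0" by auto
  have "r $ 1 * ?D = 0" "r $ 2 * ?D = 0" using rw rq by algebra+
  with D have "r $ 1 = 0" "r $ 2 = 0" by auto
  then have "r = 0" by (simp add: vec_eq_iff forall_2)
  then show ?thesis by (simp add: r_def)
qed

text \<open>
  The right-hand side is the quantity that strong differentiability controls: replacing \<open>f\<close> by
  its linear part costs little, however the two points approach the limit point.
\<close>

lemma norm_secant_gradient_diff:
  assumes "u \<noteq> v"
  shows "norm (secant_gradient f u v - (inner g (u - v) / (norm (u - v))\<^sup>2) *\<^sub>R (u - v)) =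
    \<bar>f u - f v - inner g (u - v)\<bar> / norm (u - v)"
  using assms unfolding secant_gradient_def scaleR_diff_left[symmetric] diff_divide_distrib[symmetric]
  by (simp add: power2_eq_square abs_mult)

text \<open>
  The gradient is the sum of its projections onto the directions of \<open>c - b\<close> and of
  \<open>a - mirror a b c\<close>, and each secant gradient is close to one of them.
\<close>

lemma secant_gradients_tendsto:
  fixes f :: "real ^ 2 \<Rightarrow> real"
  assumes "has_strong_gradient f \<Omega> x0 g"
  shows "((\<lambda>(a, b, c). secant_gradient f c b + secant_gradient f a (mirror a b c)) \<longlongrightarrow> g)
    (at (x0, x0, x0) within
      {(a, b, c). a \<in> \<Omega> \<and> b \<in> \<Omega> \<and> c \<in> \<Omega> \<and> mirror a b c \<in> \<Omega> \<and> \<not> collinear {a, b, c}})"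
    (is "(?F \<longlongrightarrow> g) (at _ within ?S)")
  unfolding Lim_within
proof (intro allI impI)
  fix e :: real assume "e > 0"
  then have "e / 2 > 0" by simp
  with assms obtain d where d: "d > 0" and
    strong: "\<And>u v. u \<in> \<Omega> \<Longrightarrow> v \<in> \<Omega> \<Longrightarrow> u \<noteq> v \<Longrightarrow> norm (u - x0) < d \<Longrightarrow> norm (v - x0) < d \<Longrightarrow>
      \<bar>f u - f v - inner g (u - v)\<bar> < e / 2 * norm (u - v)"
    unfolding has_strong_gradient_def by meson
  \<comment> \<open>A third of \<open>d\<close> suffices because the mirrored point is within \<open>|a - x0| + 2 |b - x0|\<close> of \<open>x0\<close>.\<close>
  have "dist (?F (a, b, c)) g < e"
    if S: "(a, b, c) \<in> ?S" and near: "dist (a, b, c) (x0, x0, x0) < d / 3" for a b c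
  proof -
    let ?m = "mirror a b c"
    have nc: "\<not> collinear {a, b, c}" using S by simp
    have "dist a x0 < d / 3" "dist b x0 < d / 3" "dist c x0 < d / 3"
      using near dist_fst_le[of "(a, b, c)" "(x0, x0, x0)"]
        dist_snd_le[of "(a, b, c)" "(x0, x0, x0)"] dist_fst_le[of "(b, c)" "(x0, x0)"]
        dist_snd_le[of "(b, c)" "(x0, x0)"] by auto
    moreover have "norm (?m - x0) \<le> norm (a - x0) + 2 * norm (b - x0)"
    proof -
      have "norm (?m - x0) \<le> norm (?m - b) + norm (b - x0)"
        using norm_triangle_ineq[of "?m - b" "b - x0"] by simp
      also have "norm (?m - b) \<le> norm (a - x0) + norm (b - x0)"
        unfolding norm_mirror_diff using norm_triangle_ineq4[of "a - x0" "b - x0"] by simp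
      finally show ?thesis by simp
    qed
    ultimately have close: "norm (a - x0) < d" "norm (b - x0) < d" "norm (c - x0) < d"
        "norm (?m - x0) < d"
      using d by (simp_all add: dist_norm)
    have neq: "c \<noteq> b" "a \<noteq> ?m"
      using nc mirror_neq[OF nc] by auto
    let ?P = "\<lambda>u v. (inner g (u - v) / (norm (u - v))\<^sup>2) *\<^sub>R (u - v)"
    have err: "norm (secant_gradient f u v - ?P u v) < e / 2"
      if "u \<in> \<Omega>" "v \<in> \<Omega>" "u \<noteq> v" "norm (u - x0) < d" "norm (v - x0) < d" for u v
      using strong[OF that] that(3) by (simp add: norm_secant_gradient_diff divide_less_eq)
    have g: "?P c b + ?P a ?m = g"
      using neq by (intro orthogonal_expansion_plane mirror_displacement_orthogonal) auto
    have "dist (?F (a, b, c)) g =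
        norm ((secant_gradient f c b + secant_gradient f a ?m) - (?P c b + ?P a ?m))"
      by (simp only: g dist_norm prod.case)
    also have "\<dots> = norm ((secant_gradient f c b - ?P c b) + (secant_gradient f a ?m - ?P a ?m))"
      by (simp only: add_diff_add)
    also have "\<dots> \<le> norm (secant_gradient f c b - ?P c b) + norm (secant_gradient f a ?m - ?P a ?m)"
      by (rule norm_triangle_ineq)
    also have "\<dots> < e / 2 + e / 2"
      using S neq close by (intro add_strict_mono err) auto
    finally show ?thesis by simp
  qed
  then have "dist (?F x) g < e" if "x \<in> ?S" "dist x (x0, x0, x0) < d / 3" for x
    using that by (cases x rule: prod_cases3) blast
  then show "\<exists>d>0. \<forall>x\<in>?S. 0 < dist x (x0, x0, x0) \<and> dist x (x0, x0, x0) < d \<longrightarrow> dist (?F x) g < e"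
    using d by (intro exI[of _ "d / 3"] conjI ballI impI) (simp, blast)
qed

theorem theorem1:
  fixes f :: "real ^ 2 \<Rightarrow> real" and \<Omega> :: "(real ^ 2) set" and x0 :: "real ^ 2"
  assumes "x0 \<in> interior \<Omega>"
    and "strongly_differentiable f \<Omega> x0"
  shows "((\<lambda>(a, b, c). vec_cl (mean_multi_diff f a b c) * cl_inverse (triangle_bivector a b c))
           \<longlongrightarrow> vec_cl (gradient f x0))
         (at (x0, x0, x0) within
           {(a, b, c). a \<in> \<Omega> \<and> b \<in> \<Omega> \<and> c \<in> \<Omega> \<and> mirror a b c \<in> \<Omega> \<and> \<not> collinear {a, b, c}})"
    (is "(?L \<longlongrightarrow> _) (at ?x within ?S)")
proof -
  let ?F = "\<lambda>(a, b, c). secant_gradient f c b + secant_gradient f a (mirror a b c)"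
  have "has_strong_gradient f \<Omega> x0 (gradient f x0)"
    using assms has_strong_gradient_imp_gradient unfolding strongly_differentiable_def by blast
  then have "(?F \<longlongrightarrow> gradient f x0) (at ?x within ?S)"
    by (rule secant_gradients_tendsto)
  moreover have "bounded_linear (vec_cl :: real ^ 2 \<Rightarrow> 2 clifford)"
    using linear_vec_cl by (simp add: linear_conv_bounded_linear)
  ultimately have "((\<lambda>x. vec_cl (?F x)) \<longlongrightarrow> vec_cl (gradient f x0)) (at ?x within ?S)"
    by (rule bounded_linear.tendsto[rotated])
  moreover have "vec_cl (?F x) = ?L x" if "x \<in> ?S" for x
    using that by (auto simp: mean_multi_diff_quotient)
  then have "\<forall>\<^sub>F x in at ?x within ?S. vec_cl (?F x) = ?L x"
    by (simp add: eventually_at_filter)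
  ultimately show ?thesis
    by (rule Lim_transform_eventually)
qed

end
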